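(* Let $M_{06},M_{16}\in SL(2,\mathbb C)$ have eigenvalues $r_\nu,1/r_\nu$ with $r_\nu\in\mathbb C\setminus\{0,\pm1\}$, $\nu=0,1$, and consider the Problem described in the context. Its solution is described by the following cases. 1. If $\mathrm{tr}(M_{06}-1/r_0)(M_{16}-r_1)=0$ and $[M_{06},M_{16}]\neq0$, then the Problem is solvable. In this case one of the following holds. (1a) Both $(M_{06}-r_0)(M_{16}-1/r_1)=0$ and $(M_{16}-r_1)(M_{06}-1/r_0)=0$. Then all solutions have $f_1=0$, $f_0\in\mathbb C\setminus\{0\}$; for any such pair there are two matrices $K$, differing only by the choice of sign, given by $K^{-1}=(e_{11},e_{1-1})\varkappa_1^{\sigma_3}$, $\varkappa_1=\sqrt{\alpha_0(r_0-1/r_0)/f_0}$, where the eigenvectors are chosen with $e_{11}=e_{01}$, and $e_{1-1}=\alpha_0e_{01}+\beta_0e_{0-1}$, $\alpha_0,\beta_0\in\mathbb C\setminus\{0\}$. (1b) Both $(M_{06}-1/r_0)(M_{16}-r_1)=0$ and $(M_{16}-1/r_1)(M_{06}-r_0)=0$. Then all solutions have $f_0=0$, $f_1\in\mathbb C\setminus\{0\}$; for any such pair there are two matrices $K$, differing only by the choice of sign, given by $K^{-1}=(e_{01},e_{0-1})\varkappa_0^{\sigma_3}$, $\varkappa_0=\sqrt{f_1/(\beta_1(1/r_1-r_1))}$, where the eigenvectors are chosen with $e_{1-1}=e_{0-1}$, and $e_{01}=\alpha_1e_{11}+\beta_1e_{1-1}$, $\alpha_1,\beta_1\in\mathbb C\setminus\{0\}$.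 2. If $\mathrm{tr}(M_{06}-1/r_0)(M_{16}-r_1)=0$ and $[M_{06},M_{16}]=0$, then the Problem is solvable, with $f_0=f_1=0$, and the general solution of the equations $KM_{\nu6}=M_{\nu\Delta}K$, $\nu=0,1$, can be presented as $K=k^{\sigma_3}K_0$, $k\in\mathbb C\setminus\{0\}$, $K_0^{-1}=(e_{01},e_{0-1})$, where in this case the eigenvectors are normalized by $\|e_{0\epsilon}\|_{\mathbb C^2}=1$. 3. If $\mathrm{tr}(M_{06}-1/r_0)(M_{16}-1/r_1)=0$, then there are two subcases. (3a) $(M_{06}-r_0)(M_{16}-r_1)=0$ and $(M_{16}-1/r_1)(M_{06}-1/r_0)=0$. Then the Problem is unsolvable. (3b) $(M_{06}-1/r_0)(M_{16}-1/r_1)=0$. Then the Problem is solvable; all solutions are the pairs $(f_0,f_1)$ with $f_0,f_1\in\mathbb C\setminus\{0\}$ and $$f_0f_1=-(r_0-1/r_0)(r_1-1/r_1).$$ For any such pair there are two matrices, $K$ and $-K$, satisfying the equations of the Problem; formula ( * ) below, for the different choices of the branch of the square root, gives both. 4. If the conditions 1–3 do not hold, then the Problem is solvable; all solutions are the pairs $(f_0,f_1)$ with $f_0,f_1\in\mathbb C\setminus\{0\}$ and $$f_0f_1=\mathrm{tr}(M_{16}-r_1)(M_{06}-1/r_0)=\mathrm{tr}(M_{16}-1/r_1)(M_{06}-r_0)$$ $$=\mathrm{tr}(M_{06}-1/r_0)(M_{16}-1/r_1)-(r_0-1/r_0)(r_1-1/r_1)=(r_0+r_1)(1/r_0+1/r_1)-\det(M_{06}+M_{16}).$$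 For a fixed such pair $(f_0,f_1)$ there are only two matrices $K$, both given by $$( * )\qquad K^{-1}=(\gamma_0e_{01},\gamma_1e_{1-1}),\qquad\gamma_0=\sqrt{\frac{f_1}{qs(r_1-1/r_1)}},\qquad\gamma_1=\frac1{\gamma_0s},$$ and specified by the choice of branch of the square root, where $p,q,r,s\in\mathbb C$, $ps-qr=1$, are defined by $e_{11}=pe_{01}+qe_{0-1}$, $e_{1-1}=re_{01}+se_{0-1}$.
   Context: $\sigma_3=\mathrm{diag}(1,-1)$, $c^{\sigma_3}=\mathrm{diag}(c,c^{-1})$; a scalar subtracted from a matrix means that multiple of $I$; $[A,B]=AB-BA$. For $f_0,f_1\in\mathbb C$ put $$M_{0\Delta}=\begin{pmatrix}r_0&f_0\\0&1/r_0\end{pmatrix},\qquad M_{1\Delta}=\begin{pmatrix}r_1&0\\ {f_1}&1/r_1\end{pmatrix}.$$ **Problem.** For given $M_{06},M_{16}$ (and $r_0,r_1$) find parameters $f_0,f_1\in\mathbb C$ such that there exists $K\in SL(2,\mathbb C)$ with $KM_{\nu6}=M_{\nu\Delta}K$ for $\nu=0,1$. A pair $(f_0,f_1)$ for which such $K$ exists is a solution of the Problem; the Problem is solvable if a solution exists. **Eigenvectors.** For $\nu=0,1$ and $\epsilon=1,-1$, $e_{\nu\epsilon}\in\mathbb C^2$ is a column eigenvector, $(M_{\nu6}-r_\nu^\epsilon)e_{\nu\epsilon}=0$, normalized, except in case 2, by $\det(e_{\nu1},e_{\nu-1})=1$; $(e,e')$ denotes the matrix with columns $e,e'$.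
   Formalization: In case 2 a scalar factor c is inserted: invertible solutions are K = c k^{σ3}K_0, those in SL(2,C) have c^2 = det(e_{01},e_{0-1}); without it the claim fails for non-orthogonal eigenvectors. Case 3b is asserted only when 3a fails, since both can hold and the Problem is then unsolvable. *)

theory Defs
  imports "HOL-Analysis.Analysis"
begin

type_synonym cvec = "complex ^ 2"
type_synonym cmat = "complex ^ 2 ^ 2"

definition mat2 :: "complex \<Rightarrow> complex \<Rightarrow> complex \<Rightarrow> complex \<Rightarrow> cmat" where
  "mat2 a b c d = vector [vector [a, b], vector [c, d]]"

definition cols :: "cvec \<Rightarrow> cvec \<Rightarrow> cmat" where
  "cols e e' = transpose (vector [e, e'])"

definition sigma3_pow :: "complex \<Rightarrow> cmat" where
  "sigma3_pow c = mat2 c 0 0 (1 / c)"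

definition SL2 :: "cmat set" where
  "SL2 = {A. det A = 1}"

definition commutator :: "cmat \<Rightarrow> cmat \<Rightarrow> cmat" where
  "commutator A B = A ** B - B ** A"

definition is_eigenvector :: "cmat \<Rightarrow> complex \<Rightarrow> cvec \<Rightarrow> bool" where
  "is_eigenvector M c e \<longleftrightarrow> e \<noteq> 0 \<and> (M - mat c) *v e = 0"

definition eigenvalues :: "cmat \<Rightarrow> complex set" where
  "eigenvalues M = {c. \<exists>e. is_eigenvector M c e}"

definition normalized_eigenvectors :: "cmat \<Rightarrow> complex \<Rightarrow> cvec \<Rightarrow> cvec \<Rightarrow> bool" where
  "normalized_eigenvectors M r e e' \<longleftrightarrow>
     is_eigenvector M r e \<and> is_eigenvector M (1 / r) e' \<and> det (cols e e') = 1"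

definition unit_eigenvectors :: "cmat \<Rightarrow> complex \<Rightarrow> cvec \<Rightarrow> cvec \<Rightarrow> bool" where
  "unit_eigenvectors M r e e' \<longleftrightarrow>
     is_eigenvector M r e \<and> is_eigenvector M (1 / r) e' \<and> norm e = 1 \<and> norm e' = 1"

definition M0_Delta :: "complex \<Rightarrow> complex \<Rightarrow> cmat" where
  "M0_Delta r0 f0 = mat2 r0 f0 0 (1 / r0)"

definition M1_Delta :: "complex \<Rightarrow> complex \<Rightarrow> cmat" where
  "M1_Delta r1 f1 = mat2 r1 0 f1 (1 / r1)"

definition intertwines ::
  "cmat \<Rightarrow> cmat \<Rightarrow> complex \<Rightarrow> complex \<Rightarrow> complex \<Rightarrow> complex \<Rightarrow> cmat \<Rightarrow> bool" where
  "intertwines M06 M16 r0 r1 f0 f1 K \<longleftrightarrow>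
     K ** M06 = M0_Delta r0 f0 ** K \<and> K ** M16 = M1_Delta r1 f1 ** K"

definition problem_matrices ::
  "cmat \<Rightarrow> cmat \<Rightarrow> complex \<Rightarrow> complex \<Rightarrow> complex \<Rightarrow> complex \<Rightarrow> cmat set" where
  "problem_matrices M06 M16 r0 r1 f0 f1 = {K \<in> SL2. intertwines M06 M16 r0 r1 f0 f1 K}"

definition problem_solutions ::
  "cmat \<Rightarrow> cmat \<Rightarrow> complex \<Rightarrow> complex \<Rightarrow> (complex \<times> complex) set" where
  "problem_solutions M06 M16 r0 r1 = {(f0, f1). problem_matrices M06 M16 r0 r1 f0 f1 \<noteq> {}}"

definition solvable :: "cmat \<Rightarrow> cmat \<Rightarrow> complex \<Rightarrow> complex \<Rightarrow> bool" where
  "solvable M06 M16 r0 r1 \<longleftrightarrow> problem_solutions M06 M16 r0 r1 \<noteq> {}"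

text \<open>The matrices \<open>K\<close> with \<open>K\<inverse> = X g\<close>, where \<open>g\<close> runs over both square roots of \<open>w\<close>.\<close>

definition matrices_via_sqrt :: "complex \<Rightarrow> (complex \<Rightarrow> cmat) \<Rightarrow> cmat set" where
  "matrices_via_sqrt w X = {K. \<exists>g. g ^ 2 = w \<and> invertible K \<and> matrix_inv K = X g}"

definition star_matrices ::
  "complex \<Rightarrow> complex \<Rightarrow> complex \<Rightarrow> complex \<Rightarrow> cvec \<Rightarrow> cvec \<Rightarrow> cmat set" where
  "star_matrices r1 f1 q s e0p e1m =
     matrices_via_sqrt (f1 / (q * s * (r1 - 1 / r1)))
       (\<lambda>\<gamma>0. cols (\<gamma>0 *s e0p) ((1 / (\<gamma>0 * s)) *s e1m))"

end

theory Submission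
  imports Defs
begin

text \<open>The columns of \<open>K\<inverse>\<close> must be an eigenvector of \<open>M06\<close> for \<open>r0\<close> and one of \<open>M16\<close> for \<open>1/r1\<close>,
  so \<open>K\<inverse> = (a e, b e')\<close> with \<open>e\<close>, \<open>e'\<close> fixed, and the Problem reduces to scalar equations for
  \<open>a\<close>, \<open>b\<close>: the determinant condition \<open>a b s = 1\<close> and one equation for each of \<open>f0\<close>, \<open>f1\<close>.
  The entries \<open>p, q, r, s\<close> of the change of eigenbasis are symplectic products of
  eigenvectors, and \<open>M - 1/r\<close>, \<open>M - r\<close> have rank one, so every trace and product in the case
  distinction is an explicit monomial in \<open>p, q, r, s\<close>.\<close>

section \<open>The symplectic form on C^2 and rank-one matrices\<close>

definition wedge :: "cvec \<Rightarrow> cvec \<Rightarrow> complex" where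
  "wedge x y = x $ 1 * y $ 2 - x $ 2 * y $ 1"

text \<open>The operator sending \<open>z\<close> to \<open>wedge z y *s x\<close>. Every 2x2 matrix
  of rank at most one has this form; for nonzero \<open>x\<close> and \<open>y\<close> its image is
  the line of \<open>x\<close> and its kernel the line of \<open>y\<close>.\<close>

definition rank1 :: "cvec \<Rightarrow> cvec \<Rightarrow> cmat" where
  "rank1 x y = mat2 (x $ 1 * y $ 2) (- (x $ 1 * y $ 1)) (x $ 2 * y $ 2) (- (x $ 2 * y $ 1))"

lemma mat2_nth [simp]:
  "mat2 a b c d $ 1 $ 1 = a" "mat2 a b c d $ 1 $ 2 = b"
  "mat2 a b c d $ 2 $ 1 = c" "mat2 a b c d $ 2 $ 2 = d"
  by (simp_all add: mat2_def)

lemma cols_nth [simp]: "cols x y $ i $ 1 = x $ i" "cols x y $ i $ 2 = y $ i"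
  by (simp_all add: cols_def transpose_def)

lemma mat_nth_2 [simp]:
  "(mat c :: cmat) $ 1 $ 1 = c" "(mat c :: cmat) $ 1 $ 2 = 0"
  "(mat c :: cmat) $ 2 $ 1 = 0" "(mat c :: cmat) $ 2 $ 2 = c"
  by (simp_all add: mat_def)

lemmas entrywise = vec_eq_iff forall_2 matrix_matrix_mult_def matrix_vector_mult_def sum_2

lemma wedge_simps [simp]:
  "wedge x x = 0" "wedge 0 y = 0" "wedge x 0 = 0" "wedge (c *s x) y = c * wedge x y" "wedge x (c *s y) = c * wedge x y"
  by (simp_all add: wedge_def algebra_simps)

lemma wedge_diff:
  "wedge x (y - z) = wedge x y - wedge x z" "wedge (x - y) z = wedge x z - wedge y z"
  by (simp_all add: wedge_def algebra_simps)

lemma wedge_swap: "wedge y x = - wedge x y"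
  by (simp add: wedge_def)

lemma det_mat2: "det (mat2 a b c d) = a * d - b * c"
  by (simp add: det_2)

lemma det_cols: "det (cols x y) = wedge x y"
  by (simp add: det_2 wedge_def)

lemma rank1_mult_vec: "rank1 x y *v z = wedge z y *s x"
  by (simp add: rank1_def wedge_def entrywise algebra_simps)

lemma rank1_mult: "rank1 a b ** rank1 c d = rank1 (wedge c b *s a) d"
  by (simp add: rank1_def wedge_def entrywise algebra_simps)

lemma trace_rank1: "trace (rank1 x y) = wedge x y"
  by (simp add: rank1_def wedge_def trace_def sum_2)

lemma rank1_eq_0_iff: "rank1 x y = 0 \<longleftrightarrow> x = 0 \<or> y = 0"
  by (auto simp: rank1_def entrywise)

text \<open>Cramer's rule in a basis of determinant 1.\<close>

lemma wedge_expand: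
  assumes "wedge u v = 1"
  shows "x = wedge x v *s u + wedge u x *s v"
proof -
  have "wedge x v * u $ 1 + wedge u x * v $ 1 = wedge u v * x $ 1"
       "wedge x v * u $ 2 + wedge u x * v $ 2 = wedge u v * x $ 2"
    by (simp_all add: wedge_def algebra_simps)
  then show ?thesis using assms by (simp add: entrywise)
qed

section \<open>Matrices as pairs of columns, and their inverses\<close>

lemma mult_cols: "A ** cols x y = cols (A *v x) (A *v y)"
  by (simp add: entrywise)

lemma cols_mult_mat2: "cols x y ** mat2 a b c d = cols (a *s x + c *s y) (b *s x + d *s y)"
  by (simp add: entrywise algebra_simps)

lemma cols_eq_iff [simp]: "cols x y = cols x' y' \<longleftrightarrow> x = x' \<and> y = y'"
  by (auto simp: entrywise)

lemma cols_surj: obtains x y where "A = cols x y"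
proof
  show "A = cols (\<chi> i. A $ i $ 1) (\<chi> i. A $ i $ 2)" by (simp add: entrywise)
qed

lemma cmat_inv_eqI:
  fixes A B :: cmat
  assumes "A ** B = mat 1"
  shows "invertible A" "matrix_inv A = B"
proof -
  have BA: "B ** A = mat 1" using assms by (simp add: matrix_left_right_inverse)
  then show inv: "invertible A" using assms by (auto simp: invertible_def)
  \<comment> \<open>\<open>matrix_inv\<close> is defined by choice, so its defining property has to
    be extracted before uniqueness of inverses identifies it with \<open>B\<close>.\<close>
  have "A ** matrix_inv A = mat 1 \<and> matrix_inv A ** A = mat 1"
    using inv unfolding invertible_def matrix_inv_def by (rule someI_ex)
  then show "matrix_inv A = B" using BA by (metis matrix_mul_assoc matrix_mul_lid matrix_mul_rid)
qed

lemma cmat_inv: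
  fixes A :: cmat
  assumes "invertible A"
  shows "A ** matrix_inv A = mat 1" "matrix_inv A ** A = mat 1"
    "invertible (matrix_inv A)" "matrix_inv (matrix_inv A) = A"
proof -
  show I: "A ** matrix_inv A = mat 1" "matrix_inv A ** A = mat 1"
    using someI_ex[OF assms[unfolded invertible_def]] by (simp_all add: matrix_inv_def)
  show "invertible (matrix_inv A)" "matrix_inv (matrix_inv A) = A"
    using cmat_inv_eqI[OF I(2)] by simp_all
qed

text \<open>Multiply by the inverse of \<open>K\<close> on both sides. The inverse X is the better
  unknown: when N is triangular, M X = X N makes one column of X satisfy an eigenvector equation of
  M.\<close>

lemma intertwine_inv_iff:
  fixes K :: cmat
  assumes "invertible K"
  shows "K ** M = N ** K \<longleftrightarrow> M ** matrix_inv K = matrix_inv K ** N"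
proof -
  let ?X = "matrix_inv K"
  note I = cmat_inv(1,2)[OF assms]
  have "M ** ?X = ?X ** (K ** M) ** ?X" "?X ** N = ?X ** (N ** K) ** ?X"
    "K ** M = K ** (M ** ?X) ** K" "N ** K = K ** (?X ** N) ** K"
    by (metis I matrix_mul_assoc matrix_mul_lid matrix_mul_rid)+
  then show ?thesis by metis
qed

lemma det_matrix_inv_eq_1_iff:
  fixes K :: cmat
  assumes "invertible K"
  shows "det (matrix_inv K) = 1 \<longleftrightarrow> det K = 1"
  using arg_cong[OF cmat_inv(1)[OF assms], of det] by (auto simp: det_mul)

lemma SL2_invertible: "K \<in> SL2 \<Longrightarrow> invertible K"
  by (simp add: SL2_def invertible_det_nz)

text \<open>The two roots g and -g of w yield the inverses X g and -X g, hence \<open>K\<close> and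
  \<open>- K\<close>; these differ because an invertible matrix is nonzero.\<close>

lemma matrices_via_sqrt_pair:
  assumes "w \<noteq> 0" and inv: "\<And>g. g \<noteq> 0 \<Longrightarrow> invertible (X g)" and odd: "\<And>g. X (- g) = - X g"
  shows "\<exists>K. K \<noteq> - K \<and> matrices_via_sqrt w X = {K, - K}"
proof -
  define g where "g = csqrt w"
  have g: "g ^ 2 = w" "g \<noteq> 0" using \<open>w \<noteq> 0\<close> by (auto simp: g_def)
  define K where "K = matrix_inv (X g)"
  note I = cmat_inv[OF inv[OF g(2)], folded K_def]
  have neg: "(- A) ** (- B) = A ** B" for A B :: cmat
    by (simp add: entrywise)
  have inv_neg: "matrix_inv (- A) = - matrix_inv A" if "invertible A" for A :: cmat
    using cmat_inv(1)[OF that] by (intro cmat_inv_eqI) (simp add: neg)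
  have roots: "h ^ 2 = w \<longleftrightarrow> h = g \<or> h = - g" for h
    using g(1) by (metis power2_eq_iff)
  have "K \<noteq> - K"
  proof
    assume "K = - K"
    then have "K = 0" by (auto simp: entrywise)
    then show False using I(3) by (simp add: invertible_det_nz det_2)
  qed
  moreover have "matrices_via_sqrt w X = {K, - K}"
  proof (intro equalityI subsetI)
    fix L assume "L \<in> matrices_via_sqrt w X"
    then obtain h where "h ^ 2 = w" "invertible L" "matrix_inv L = X h"
      by (auto simp: matrices_via_sqrt_def)
    then have "L = matrix_inv (X g) \<or> L = matrix_inv (X (- g))"
      using cmat_inv(4)[of L] roots by auto
    then show "L \<in> {K, - K}" using inv_neg[OF inv[OF g(2)]] odd K_def by auto
  next
    fix L assume "L \<in> {K, - K}"
    moreover have "invertible (- K)" "matrix_inv (- K) = X (- g)"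
      using I inv_neg[OF I(3)] by (auto simp: odd invertible_det_nz det_2)
    ultimately show "L \<in> matrices_via_sqrt w X"
      using I roots unfolding matrices_via_sqrt_def by blast
  qed
  ultimately show ?thesis by blast
qed

section \<open>Normalized eigenbases\<close>

lemma normalized_eigenvectorsD:
  assumes "normalized_eigenvectors M r u v"
  shows "wedge u v = 1" "M - mat (1 / r) = rank1 ((r - 1 / r) *s u) v"
    "M - mat r = rank1 ((r - 1 / r) *s v) u"
proof -
  show w: "wedge u v = 1" using assms by (simp add: normalized_eigenvectors_def det_cols)
  have Mu: "M *v u = r *s u" and Mv: "M *v v = (1 / r) *s v"
    using assms by (auto simp: normalized_eigenvectors_def is_eigenvector_def entrywise algebra_simps)
  have lin: "A *v (a *s x + b *s y) = a *s (A *v x) + b *s (A *v y)" for A :: cmat and a b x y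
    by (simp add: entrywise algebra_simps)
  \<comment> \<open>The spectral decomposition of \<open>M\<close>, from Cramer's rule for
    \<open>x\<close>. Subtracting one of the two eigenvalues removes one term and leaves a rank-one
    matrix.\<close>
  have M: "M *v x = (r * wedge x v) *s u + (wedge u x / r) *s v" for x
    using arg_cong[OF wedge_expand[OF w, of x], of "(*v) M"]
    by (simp add: lin Mu Mv vector_smult_assoc mult.commute)
  have shift: "(M - mat c) *v x =
      ((r - c) * wedge x v) *s u + ((1 / r - c) * wedge u x) *s v" for c x
  proof -
    have "(M - mat c) *v x = M *v x - c *s x" by (simp add: entrywise algebra_simps)
    also have "\<dots> = (r * wedge x v) *s u + (wedge u x / r) *s v
        - c *s (wedge x v *s u + wedge u x *s v)"
      using M wedge_expand[OF w, of x] by simp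
    also have "\<dots> = ((r - c) * wedge x v) *s u + ((1 / r - c) * wedge u x) *s v"
      by (simp add: entrywise algebra_simps)
    finally show ?thesis .
  qed
  show "M - mat (1 / r) = rank1 ((r - 1 / r) *s u) v"
    unfolding matrix_eq shift rank1_mult_vec by (simp add: vec_eq_iff algebra_simps)
  \<comment> \<open>Antisymmetry absorbs the sign: the surviving term (1/r - r)
    \<open>wedge u x\<close> equals (r - 1/r) \<open>wedge x u\<close>.\<close>
  show "M - mat r = rank1 ((r - 1 / r) *s v) u"
    unfolding matrix_eq shift rank1_mult_vec wedge_swap[of _ u]
    by (simp add: vec_eq_iff algebra_simps)
qed

lemma trace_normalized_eigenvectors:
  assumes "normalized_eigenvectors M r u v"
  shows "trace M = r + 1 / r"
proof -
  have "trace (M - mat (1 / r)) = r - 1 / r"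
    unfolding normalized_eigenvectorsD(2)[OF assms] trace_rank1 wedge_simps
    using normalized_eigenvectorsD(1)[OF assms] by simp
  then show ?thesis by (simp add: trace_def sum_2 algebra_simps)
qed

text \<open>By the rank-one form, the kernel of \<open>M\<close> minus an eigenvalue is the line of
  the corresponding basis vector, as the factor r - 1/r is nonzero.\<close>

lemma eigenvector_unique:
  assumes "normalized_eigenvectors M r u v" "r - 1 / r \<noteq> 0"
  shows "M *v x = r *s x \<longleftrightarrow> wedge x u = 0" "M *v x = (1 / r) *s x \<longleftrightarrow> wedge x v = 0"
proof -
  note N = normalized_eigenvectorsD[OF assms(1)]
  have nz: "u \<noteq> 0" "v \<noteq> 0" using assms(1) by (auto simp: normalized_eigenvectors_def is_eigenvector_def)
  have shift: "M *v x = c *s x \<longleftrightarrow> (M - mat c) *v x = 0" for c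
    by (simp add: entrywise algebra_simps)
  show "M *v x = r *s x \<longleftrightarrow> wedge x u = 0" "M *v x = (1 / r) *s x \<longleftrightarrow> wedge x v = 0"
    using nz assms(2) unfolding shift N(2,3) rank1_mult_vec vector_mul_eq_0 vector_smult_assoc
    by simp_all
qed

lemma wedge_eq_0D:
  assumes "wedge x u = 0" "u \<noteq> 0"
  shows "\<exists>a. x = a *s u"
proof (cases "u $ 1 = 0")
  case True
  with assms have "x = (x $ 2 / u $ 2) *s u" by (auto simp: wedge_def entrywise)
  then show ?thesis by blast
next
  case False
  with assms have "x = (x $ 1 / u $ 1) *s u" by (auto simp: wedge_def entrywise field_simps)
  then show ?thesis by blast
qed

text \<open>Eigenvectors for distinct eigenvalues are independent, so one of them can be rescaled to
  reach determinant 1. Both variants are needed: case 1a prescribes the eigenvector for r1, case 1b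
  the one for 1/r1.\<close>

lemma normalized_eigenvectors_exist:
  assumes "is_eigenvector M r x" "is_eigenvector M (1 / r) y" "r \<noteq> 0" "r - 1 / r \<noteq> 0"
  shows "wedge x y \<noteq> 0" "normalized_eigenvectors M r x ((1 / wedge x y) *s y)"
    "normalized_eigenvectors M r ((1 / wedge x y) *s x) y"
proof -
  have nz: "x \<noteq> 0" "y \<noteq> 0" and M: "M *v x = r *s x" "M *v y = (1 / r) *s y"
    using assms by (auto simp: is_eigenvector_def entrywise algebra_simps)
  show w: "wedge x y \<noteq> 0"
  proof
    assume "wedge x y = 0"
    then obtain a where a: "x = a *s y" using nz wedge_eq_0D by blast
    have "M *v x = a *s (M *v y)" unfolding a by (simp add: entrywise algebra_simps)
    also have "\<dots> = (1 / r) *s x" using M(2) a by (simp add: vector_smult_assoc mult.commute)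
    finally have "(r - 1 / r) *s x = 0" using M(1) by (simp add: entrywise algebra_simps)
    then show False using nz assms(4) by (simp add: vector_mul_eq_0)
  qed
  show "normalized_eigenvectors M r x ((1 / wedge x y) *s y)"
    "normalized_eigenvectors M r ((1 / wedge x y) *s x) y"
    using assms w nz by (auto simp: normalized_eigenvectors_def is_eigenvector_def det_cols vec.scale vector_mul_eq_0)
qed

section \<open>Traces, determinants and diagonal factors of 2x2 matrices\<close>

lemma det_add_2:
  fixes A B :: cmat
  shows "det (A + B) = det A + det B + trace A * trace B - trace (A ** B)"
  by (simp add: det_2 trace_def entrywise algebra_simps)

lemma trace_shift_mult:
  fixes A B :: cmat
  shows "trace ((A - mat c) ** (B - mat d)) =
    trace (A ** B) - c * trace B - d * trace A + 2 * c * d"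
  by (simp add: trace_def entrywise algebra_simps)

text \<open>A diagonal factor on the left of \<open>K\<close> rescales the columns of its inverse by
  the reciprocals.\<close>

lemma cmat_inv_diag:
  assumes "wedge e e' \<noteq> 0" "g \<noteq> 0" "h \<noteq> 0"
  defines "K \<equiv> mat2 g 0 0 h ** matrix_inv (cols e e')"
  shows "invertible K" "matrix_inv K = cols ((1 / g) *s e) ((1 / h) *s e')"
proof -
  have inv: "invertible (cols e e')" using assms(1) by (simp add: invertible_det_nz det_cols)
  have "cols ((1 / g) *s e) ((1 / h) *s e') = cols e e' ** mat2 (1 / g) 0 0 (1 / h)"
    by (simp add: cols_mult_mat2)
  then have "K ** cols ((1 / g) *s e) ((1 / h) *s e') =
      mat2 g 0 0 h ** (matrix_inv (cols e e') ** cols e e') ** mat2 (1 / g) 0 0 (1 / h)"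
    by (simp add: K_def matrix_mul_assoc)
  also have "\<dots> = mat 1"
    unfolding cmat_inv(2)[OF inv] using assms(2,3) by (simp add: entrywise)
  finally show "invertible K" "matrix_inv K = cols ((1 / g) *s e) ((1 / h) *s e')"
    by (rule cmat_inv_eqI)+
qed

lemma scaled_sigma3: "mat c ** (sigma3_pow k ** A) = mat2 (c * k) 0 0 (c / k) ** A"
  by (simp add: sigma3_pow_def entrywise algebra_simps)

text \<open>Splits an invertible diagonal matrix into a scalar c and a power
  \<open>sigma3_pow k\<close>: the square of k has to be g/h, and then c = g/k.\<close>

lemma sigma3_parametrization:
  fixes g h :: complex
  assumes "g \<noteq> 0" "h \<noteq> 0"
  shows "\<exists>c k. c \<noteq> 0 \<and> k \<noteq> 0 \<and> g = c * k \<and> h = c / k"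
proof -
  define k where "k = csqrt (g / h)"
  have k: "k ^ 2 = g / h" "k \<noteq> 0" using assms by (auto simp: k_def)
  then have "h = g / k / k" using assms by (auto simp: power2_eq_square field_simps)
  moreover have "g = g / k * k" "g / k \<noteq> 0" using k(2) assms by simp_all
  ultimately show ?thesis using k(2) by blast
qed

section \<open>Two eigenbases and their change of basis\<close>

locale eigenframes =
  fixes M0 M1 :: cmat and r0 r1 :: complex and u v u' v' :: cvec
  assumes frame0: "normalized_eigenvectors M0 r0 u v"
    and frame1: "normalized_eigenvectors M1 r1 u' v'"
    and d0_nz: "r0 - 1 / r0 \<noteq> 0" and d1_nz: "r1 - 1 / r1 \<noteq> 0"
begin

text \<open>By Cramer's rule these are the entries of the change of basis from \<open>u\<close>,
  \<open>v\<close> to \<open>u'\<close>, \<open>v'\<close>. The frames are locale parameters because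
  the theorem quantifies over normalized eigenvectors: the locale is interpreted once for a fixed
  choice and again for each quantified one.\<close>

abbreviation "p \<equiv> wedge u' v"
abbreviation "q \<equiv> wedge u u'"
abbreviation "r \<equiv> wedge v' v"
abbreviation "s \<equiv> wedge u v'"
abbreviation "d0 \<equiv> r0 - 1 / r0"
abbreviation "d1 \<equiv> r1 - 1 / r1"

lemmas D0 = normalized_eigenvectorsD[OF frame0]
lemmas D1 = normalized_eigenvectorsD[OF frame1]

lemma frame_nz: "u \<noteq> 0" "v \<noteq> 0" "u' \<noteq> 0" "v' \<noteq> 0"
  using frame0 frame1 by (auto simp: normalized_eigenvectors_def is_eigenvector_def)

lemma u'_eq: "u' = p *s u + q *s v" and v'_eq: "v' = r *s u + s *s v"
  using wedge_expand[OF D0(1)] by auto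

text \<open>The first column of the inverse change of basis; its coefficients become the constants
  of case 1b.\<close>

lemma u_eq: "u = s *s u' + (- q) *s v'"
  using wedge_expand[OF D1(1), of u] by (simp add: wedge_swap[of u' u])

text \<open>The Pluecker relation for four vectors in the plane, that is, multiplicativity of the
  determinant under the change of basis.\<close>

lemma ps_qr: "p * s - q * r = 1"
proof -
  have "p * s - q * r = wedge u v * wedge u' v'"
    by (simp add: wedge_def algebra_simps)
  then show ?thesis using D0(1) D1(1) by simp
qed

lemma trace_pm: "trace ((M0 - mat (1 / r0)) ** (M1 - mat r1)) = q * r * (d0 * d1)"
  unfolding D0(2,3) D1(2,3) rank1_mult trace_rank1 wedge_simps by (simp add: mult_ac)

lemma trace_pp: "trace ((M0 - mat (1 / r0)) ** (M1 - mat (1 / r1))) = p * s * (d0 * d1)"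
  unfolding D0(2,3) D1(2,3) rank1_mult trace_rank1 wedge_simps by (simp add: mult_ac)

lemma trace_mp: "trace ((M0 - mat r0) ** (M1 - mat (1 / r1))) = q * r * (d0 * d1)"
  unfolding D0(2,3) D1(2,3) rank1_mult trace_rank1 wedge_simps
  by (simp add: wedge_swap[of u' u] wedge_swap[of v v'] mult_ac)

text \<open>A product of rank-one matrices vanishes exactly when the image of the second factor lies
  in the kernel of the first. Each condition thus says that two eigenlines coincide: those of
  \<open>u\<close> and \<open>u'\<close> for q, \<open>v\<close> and \<open>v'\<close> for r,
  \<open>u\<close> and \<open>v'\<close> for s, \<open>v\<close> and \<open>u'\<close> for
  p.\<close>

lemma products_eq_0_iff:
  "(M0 - mat r0) ** (M1 - mat (1 / r1)) = 0 \<longleftrightarrow> q = 0"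
  "(M1 - mat r1) ** (M0 - mat (1 / r0)) = 0 \<longleftrightarrow> q = 0"
  "(M0 - mat (1 / r0)) ** (M1 - mat r1) = 0 \<longleftrightarrow> r = 0"
  "(M1 - mat (1 / r1)) ** (M0 - mat r0) = 0 \<longleftrightarrow> r = 0"
  "(M0 - mat r0) ** (M1 - mat r1) = 0 \<longleftrightarrow> s = 0"
  "(M1 - mat (1 / r1)) ** (M0 - mat (1 / r0)) = 0 \<longleftrightarrow> s = 0"
  "(M0 - mat (1 / r0)) ** (M1 - mat (1 / r1)) = 0 \<longleftrightarrow> p = 0"
  using d0_nz d1_nz frame_nz
  unfolding D0(2,3) D1(2,3) rank1_mult rank1_eq_0_iff vector_mul_eq_0 wedge_simps
  by (auto simp: wedge_swap[of u' u] wedge_swap[of v v'] wedge_swap[of v' u])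

text \<open>Commuting matrices with distinct eigenvalues have the same eigenlines. The hypothesis
  makes p and s nonzero and so rules out that the lines are exchanged, where the matrices commute
  with p = s = 0.\<close>

lemma commutator_eq_0_iff:
  assumes "q * r = 0"
  shows "commutator M0 M1 = 0 \<longleftrightarrow> q = 0 \<and> r = 0"
proof -
  have nz: "p \<noteq> 0" "s \<noteq> 0" using ps_qr assms by auto
  have "commutator M0 M1 = commutator (M0 - mat (1 / r0)) (M1 - mat (1 / r1))"
    by (simp add: commutator_def entrywise algebra_simps)
  also have "\<dots> = rank1 ((d0 * d1 * p) *s u) v' - rank1 ((d0 * d1 * s) *s u') v"
    unfolding commutator_def D0(2) D1(2) rank1_mult vector_smult_assoc wedge_simps
    by (simp add: mult_ac)
  also have "\<dots> = 0 \<longleftrightarrow> q = 0 \<and> r = 0"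
  proof
    let ?C = "rank1 ((d0 * d1 * p) *s u) v' - rank1 ((d0 * d1 * s) *s u') v"
    assume *: "?C = 0"
    have C: "?C *v x = (d0 * d1 * p * wedge x v') *s u - (d0 * d1 * s * wedge x v) *s u'" for x
      by (simp add: matrix_vector_mult_diff_rdistrib rank1_mult_vec vector_smult_assoc mult_ac)
    \<comment> \<open>Applying the commutator to \<open>u\<close> and pairing with \<open>u\<close>
      removes its first term and isolates q; doing the same with \<open>v\<close> removes the second
      term and isolates r.\<close>
    have "wedge u (?C *v u) = - (d0 * d1 * s) * q" "wedge (?C *v v) v = d0 * d1 * p * wedge v v'"
      unfolding C wedge_diff using D0(1) by simp_all
    then show "q = 0 \<and> r = 0" using * nz d0_nz d1_nz D0(1)
      by (auto simp: wedge_swap[of v v'])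
  next
    assume "q = 0 \<and> r = 0"
    then have "u' = p *s u" "v' = s *s v" using u'_eq v'_eq by auto
    then show "rank1 ((d0 * d1 * p) *s u) v' - rank1 ((d0 * d1 * s) *s u') v = 0"
      by (simp add: rank1_def entrywise mult_ac)
  qed
  finally show ?thesis .
qed

section \<open>The intertwining equations as scalar equations\<close>

lemma intertwines_iff:
  assumes "invertible K"
  shows "intertwines M0 M1 r0 r1 f0 f1 K \<longleftrightarrow>
    (\<exists>a b. matrix_inv K = cols (a *s u) (b *s v') \<and> a * f0 = b * r * d0 \<and> b * f1 = a * q * d1)"
proof -
  obtain x y where xy: "matrix_inv K = cols x y" by (rule cols_surj)
  have "intertwines M0 M1 r0 r1 f0 f1 K \<longleftrightarrow>
      M0 *v x = r0 *s x \<and> M0 *v y = f0 *s x + (1 / r0) *s y \<and>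
      M1 *v x = r1 *s x + f1 *s y \<and> M1 *v y = (1 / r1) *s y"
    unfolding intertwines_def intertwine_inv_iff[OF assms] xy M0_Delta_def M1_Delta_def
      mult_cols cols_mult_mat2 cols_eq_iff by auto
  also have "\<dots> \<longleftrightarrow> (\<exists>a b. x = a *s u \<and> y = b *s v' \<and>
      a * f0 = b * r * d0 \<and> b * f1 = a * q * d1)"
  proof -
    \<comment> \<open>The first and last equations place the columns on the lines of
      \<open>u\<close> and \<open>v'\<close>. In the other two, moving the eigenvalue to the left
      produces rank-one matrices, and both sides become multiples of the same vector:
      \<open>u\<close> for \<open>M0\<close>, \<open>v'\<close> for \<open>M1\<close>.\<close>
    have s1: "M *v z = w + c *s z \<longleftrightarrow> (M - mat c) *v z = w"
         and s2: "M *v z = c *s z + w \<longleftrightarrow> (M - mat c) *v z = w" for M :: cmat and c w z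
      by (auto simp: entrywise algebra_simps)
    have "M0 *v (b *s v') = f0 *s (a *s u) + (1 / r0) *s (b *s v') \<longleftrightarrow> a * f0 = b * r * d0"
      "M1 *v (a *s u) = r1 *s (a *s u) + f1 *s (b *s v') \<longleftrightarrow> b * f1 = a * q * d1" for a b
      unfolding s1 s2
      unfolding D0(2) D1(3) rank1_mult_vec vector_smult_assoc vector_mul_rcancel wedge_simps
      using frame_nz by (auto simp: mult_ac)
    moreover have "M0 *v (a *s u) = r0 *s (a *s u)" "M1 *v (b *s v') = (1 / r1) *s (b *s v')" for a b
      unfolding eigenvector_unique(1)[OF frame0 d0_nz] eigenvector_unique(2)[OF frame1 d1_nz]
      by simp_all
    moreover have "\<exists>a. x = a *s u" if "M0 *v x = r0 *s x"
      using that eigenvector_unique(1)[OF frame0 d0_nz] wedge_eq_0D frame_nz by blast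
    moreover have "\<exists>b. y = b *s v'" if "M1 *v y = (1 / r1) *s y"
      using that eigenvector_unique(2)[OF frame1 d1_nz] wedge_eq_0D frame_nz by blast
    ultimately show ?thesis by metis
  qed
  finally show ?thesis by (simp add: xy)
qed

lemma problem_matrices_iff:
  "K \<in> problem_matrices M0 M1 r0 r1 f0 f1 \<longleftrightarrow> invertible K \<and>
    (\<exists>a b. a * b * s = 1 \<and> matrix_inv K = cols (a *s u) (b *s v') \<and>
      a * f0 = b * r * d0 \<and> b * f1 = a * q * d1)"
proof (cases "invertible K")
  case True
  then have "K \<in> problem_matrices M0 M1 r0 r1 f0 f1 \<longleftrightarrow>
      det (matrix_inv K) = 1 \<and> intertwines M0 M1 r0 r1 f0 f1 K"
    by (auto simp: problem_matrices_def SL2_def det_matrix_inv_eq_1_iff)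
  moreover have "det (cols (a *s u) (b *s v')) = a * b * s" for a b
    by (simp add: det_cols)
  ultimately show ?thesis using True unfolding intertwines_iff[OF True] by metis
qed (auto simp: problem_matrices_def dest: SL2_invertible)

lemma problem_solutions_iff:
  "(f0, f1) \<in> problem_solutions M0 M1 r0 r1 \<longleftrightarrow>
    (\<exists>a b. a * b * s = 1 \<and> a * f0 = b * r * d0 \<and> b * f1 = a * q * d1)"
proof
  assume "\<exists>a b. a * b * s = 1 \<and> a * f0 = b * r * d0 \<and> b * f1 = a * q * d1"
  then obtain a b where ab: "a * b * s = 1" "a * f0 = b * r * d0" "b * f1 = a * q * d1" by blast
  then have "det (cols (a *s u) (b *s v')) \<noteq> 0" by (auto simp: det_cols mult.assoc)
  then have "invertible (cols (a *s u) (b *s v'))" by (simp add: invertible_det_nz)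
  from cmat_inv(3,4)[OF this] ab
  have "matrix_inv (cols (a *s u) (b *s v')) \<in> problem_matrices M0 M1 r0 r1 f0 f1"
    unfolding problem_matrices_iff by blast
  then show "(f0, f1) \<in> problem_solutions M0 M1 r0 r1" by (auto simp: problem_solutions_def)
next
  assume "(f0, f1) \<in> problem_solutions M0 M1 r0 r1"
  then obtain K where "K \<in> problem_matrices M0 M1 r0 r1 f0 f1"
    by (auto simp: problem_solutions_def)
  then show "\<exists>a b. a * b * s = 1 \<and> a * f0 = b * r * d0 \<and> b * f1 = a * q * d1"
    unfolding problem_matrices_iff by blast
qed

section \<open>Solution sets, according to which of q, r, s vanish\<close>

lemma not_solvable: "s = 0 \<Longrightarrow> \<not> solvable M0 M1 r0 r1"
  using problem_solutions_iff by (auto simp: solvable_def)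

text \<open>The determinant condition eliminates b = 1/(a s), and both remaining equations involve a
  only through its square. The hypothesis \<open>eq\<close> says that together they prescribe this
  square; it is verified from the second equation if q is nonzero and from the first if q = 0 and r
  is nonzero.\<close>

lemma problem_matrices_sqrt:
  assumes "s \<noteq> 0" "w \<noteq> 0"
    and eq: "\<And>a. a \<noteq> 0 \<Longrightarrow> a ^ 2 * s * f0 = r * d0 \<and> f1 = a ^ 2 * s * q * d1 \<longleftrightarrow> a ^ 2 = w"
  defines "X \<equiv> \<lambda>a. cols (a *s u) ((1 / (a * s)) *s v')"
  shows "problem_matrices M0 M1 r0 r1 f0 f1 = matrices_via_sqrt w X"
    "\<exists>K. K \<noteq> - K \<and> problem_matrices M0 M1 r0 r1 f0 f1 = {K, - K}"
proof -
  have iff: "a * b * s = 1 \<and> a * f0 = b * r * d0 \<and> b * f1 = a * q * d1 \<longleftrightarrow>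
      b = 1 / (a * s) \<and> a ^ 2 = w" for a b
  proof (cases "a = 0")
    case False
    have "a * b * s = 1 \<longleftrightarrow> b = 1 / (a * s)" using False \<open>s \<noteq> 0\<close> by (auto simp: field_simps)
    moreover have "a * f0 = 1 / (a * s) * r * d0 \<and> 1 / (a * s) * f1 = a * q * d1 \<longleftrightarrow>
        a ^ 2 * s * f0 = r * d0 \<and> f1 = a ^ 2 * s * q * d1"
      using False \<open>s \<noteq> 0\<close> by (simp add: nonzero_eq_divide_eq nonzero_divide_eq_eq power2_eq_square mult_ac)
    ultimately show ?thesis using eq[OF False] by auto
  \<comment> \<open>For a = 0 both sides fail: the left by a b s = 1, the right because w is
    nonzero.\<close>
  qed (use \<open>w \<noteq> 0\<close> in auto)
  show eq: "problem_matrices M0 M1 r0 r1 f0 f1 = matrices_via_sqrt w X"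
    unfolding set_eq_iff problem_matrices_iff matrices_via_sqrt_def X_def mem_Collect_eq
    using iff by metis
  have "invertible (X a)" if "a \<noteq> 0" for a
    using that \<open>s \<noteq> 0\<close> by (simp add: X_def invertible_det_nz det_cols)
  moreover have "X (- a) = - X a" for a
    by (simp add: X_def entrywise)
  ultimately show "\<exists>K. K \<noteq> - K \<and> problem_matrices M0 M1 r0 r1 f0 f1 = {K, - K}"
    unfolding eq by (intro matrices_via_sqrt_pair \<open>w \<noteq> 0\<close>)
qed

text \<open>With q nonzero the equation for f1 determines the square of a, which is the radicand in
  \<open>star_matrices\<close>. The value r = 0 is allowed, so that case 1b is covered along with 3b
  and 4.\<close>

lemma solutions_lower:
  assumes "q \<noteq> 0" "s \<noteq> 0"
  shows "problem_solutions M0 M1 r0 r1 = {(f0, f1). f1 \<noteq> 0 \<and> f0 * f1 = q * r * (d0 * d1)}"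
    (is "_ = ?S")
    and "(f0, f1) \<in> problem_solutions M0 M1 r0 r1 \<Longrightarrow>
      (\<exists>K. K \<noteq> - K \<and> problem_matrices M0 M1 r0 r1 f0 f1 = {K, - K}) \<and>
      problem_matrices M0 M1 r0 r1 f0 f1 = star_matrices r1 f1 q s u v'"
proof -
  have sub: "f1 \<noteq> 0 \<and> f0 * f1 = q * r * (d0 * d1)"
    if sol: "(f0, f1) \<in> problem_solutions M0 M1 r0 r1" for f0 f1
  proof -
    obtain a b where ab: "a * b * s = 1" "a * f0 = b * r * d0" "b * f1 = a * q * d1"
      using sol problem_solutions_iff by blast
    then have nz: "a \<noteq> 0" "b \<noteq> 0" by auto
    \<comment> \<open>Multiplying the two scalar equations lets a b cancel and leaves the condition
      on f0 f1.\<close>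
    have "(a * b) * (f0 * f1) = (a * f0) * (b * f1)" by simp
    also have "\<dots> = (a * b) * (q * r * (d0 * d1))" unfolding ab by simp
    finally show ?thesis using nz ab(3) assms d1_nz by auto
  qed
  have mats: "problem_matrices M0 M1 r0 r1 f0 f1 = star_matrices r1 f1 q s u v' \<and>
      (\<exists>K. K \<noteq> - K \<and> problem_matrices M0 M1 r0 r1 f0 f1 = {K, - K})"
    if f: "f1 \<noteq> 0" "f0 * f1 = q * r * (d0 * d1)" for f0 f1
  proof -
    let ?w = "f1 / (q * s * d1)"
    have "a ^ 2 * s * f0 = r * d0 \<and> f1 = a ^ 2 * s * q * d1 \<longleftrightarrow> a ^ 2 = ?w" for a
    proof -
      have 1: "a ^ 2 = ?w \<longleftrightarrow> f1 = a ^ 2 * s * q * d1"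
        using assms d1_nz by (auto simp: nonzero_eq_divide_eq mult_ac)
      \<comment> \<open>Given the product condition, the equation for f0 follows from the one for f1
        after cancelling q d1.\<close>
      have "a ^ 2 * s * f0 = r * d0" if "f1 = a ^ 2 * s * q * d1"
      proof -
        have "(q * d1) * (a ^ 2 * s * f0) = f0 * f1" unfolding that by simp
        also have "\<dots> = (q * d1) * (r * d0)" unfolding f by simp
        finally show ?thesis using assms d1_nz by simp
      qed
      with 1 show ?thesis by auto
    qed
    moreover have "?w \<noteq> 0" using f assms d1_nz by simp
    ultimately show ?thesis
      using problem_matrices_sqrt[OF assms(2)] unfolding star_matrices_def by blast
  qed
  have sol: "(f0, f1) \<in> problem_solutions M0 M1 r0 r1" if "f1 \<noteq> 0" "f0 * f1 = q * r * (d0 * d1)" for f0 f1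
    using mats[OF that] unfolding problem_solutions_def by blast
  have "(f0, f1) \<in> problem_solutions M0 M1 r0 r1 \<longleftrightarrow> (f0, f1) \<in> ?S" for f0 f1
    unfolding mem_Collect_eq prod.case using sub sol by blast
  then show "problem_solutions M0 M1 r0 r1 = ?S" by (simp add: set_eq_iff)
  show "(\<exists>K. K \<noteq> - K \<and> problem_matrices M0 M1 r0 r1 f0 f1 = {K, - K}) \<and>
      problem_matrices M0 M1 r0 r1 f0 f1 = star_matrices r1 f1 q s u v'"
    if "(f0, f1) \<in> problem_solutions M0 M1 r0 r1" using mats[of f1 f0] sub[OF that] by metis
qed

text \<open>With q = 0 the second equation forces f1 = 0 and no longer restricts a, so the equation
  for f0 takes over; s is nonzero because p s = 1.\<close>

lemma solutions_upper:
  assumes "q = 0" "r \<noteq> 0"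
  shows "problem_solutions M0 M1 r0 r1 = {(f0, f1). f0 \<noteq> 0 \<and> f1 = 0}" (is "_ = ?S")
    and "(f0, f1) \<in> problem_solutions M0 M1 r0 r1 \<Longrightarrow>
      (\<exists>K. K \<noteq> - K \<and> problem_matrices M0 M1 r0 r1 f0 f1 = {K, - K}) \<and>
      problem_matrices M0 M1 r0 r1 f0 f1 = matrices_via_sqrt (r * d0 / (s * f0))
        (\<lambda>a. cols (a *s u) ((1 / (a * s)) *s v'))"
proof -
  have s: "s \<noteq> 0" using ps_qr assms(1) by auto
  have sub: "f0 \<noteq> 0 \<and> f1 = 0" if "(f0, f1) \<in> problem_solutions M0 M1 r0 r1" for f0 f1
    using that assms d0_nz unfolding problem_solutions_iff by auto
  have mats: "(\<exists>K. K \<noteq> - K \<and> problem_matrices M0 M1 r0 r1 f0 0 = {K, - K}) \<and>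
      problem_matrices M0 M1 r0 r1 f0 0 = matrices_via_sqrt (r * d0 / (s * f0))
        (\<lambda>a. cols (a *s u) ((1 / (a * s)) *s v'))" if "f0 \<noteq> 0" for f0
  proof -
    let ?w = "r * d0 / (s * f0)"
    have "a ^ 2 * s * f0 = r * d0 \<and> 0 = a ^ 2 * s * q * d1 \<longleftrightarrow> a ^ 2 = ?w" for a
      using that s assms by (auto simp: nonzero_eq_divide_eq mult_ac)
    moreover have "?w \<noteq> 0" using that s assms d0_nz by simp
    ultimately show ?thesis using problem_matrices_sqrt[OF s] by blast
  qed
  have sol: "(f0, 0) \<in> problem_solutions M0 M1 r0 r1" if "f0 \<noteq> 0" for f0
    using mats[OF that] unfolding problem_solutions_def by blast
  have "(f0, f1) \<in> problem_solutions M0 M1 r0 r1 \<longleftrightarrow> (f0, f1) \<in> ?S" for f0 f1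
    unfolding mem_Collect_eq prod.case using sub sol by blast
  then show "problem_solutions M0 M1 r0 r1 = ?S" by (simp add: set_eq_iff)
  show "(\<exists>K. K \<noteq> - K \<and> problem_matrices M0 M1 r0 r1 f0 f1 = {K, - K}) \<and>
      problem_matrices M0 M1 r0 r1 f0 f1 = matrices_via_sqrt (r * d0 / (s * f0))
        (\<lambda>a. cols (a *s u) ((1 / (a * s)) *s v'))"
    if "(f0, f1) \<in> problem_solutions M0 M1 r0 r1"
    using mats[of f0] sub[OF that] by metis
qed

lemma solutions_diagonal:
  assumes "q = 0" "r = 0"
  shows "problem_solutions M0 M1 r0 r1 = {(0, 0)}"
proof -
  have s: "s \<noteq> 0" using ps_qr assms by auto
  have "(f0, f1) \<in> problem_solutions M0 M1 r0 r1 \<longleftrightarrow> f0 = 0 \<and> f1 = 0" for f0 f1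
  proof
    assume "f0 = 0 \<and> f1 = 0"
    \<comment> \<open>The witness is a = 1, b = 1/s; the other two equations read 0 = 0.\<close>
    moreover have "1 * (1 / s) * s = 1" using s by simp
    ultimately show "(f0, f1) \<in> problem_solutions M0 M1 r0 r1"
      unfolding problem_solutions_iff using assms by (metis mult_zero_left mult_zero_right)
  qed (use assms in \<open>auto simp: problem_solutions_iff\<close>)
  then show ?thesis by auto
qed

text \<open>Here \<open>M0\<close> and \<open>M1\<close> are diagonal in a common basis, nothing
  links a and b, and \<open>K\<close> is determined up to an invertible diagonal factor. The
  eigenvectors \<open>e\<close>, \<open>e'\<close> are only required to be independent, to admit the
  normalization by length in case 2.\<close>

lemma intertwines_diagonal_iff:
  assumes "q = 0" "r = 0" "is_eigenvector M0 r0 e" "is_eigenvector M0 (1 / r0) e'"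
    and w: "wedge e e' \<noteq> 0"
  shows "invertible K \<and> intertwines M0 M1 r0 r1 0 0 K \<longleftrightarrow>
    (\<exists>g h. g \<noteq> 0 \<and> h \<noteq> 0 \<and> K = mat2 g 0 0 h ** matrix_inv (cols e e'))"
proof -
  obtain \<sigma> where v': "v' = \<sigma> *s v" "\<sigma> \<noteq> 0"
    using v'_eq assms(2) ps_qr assms(1) by fastforce
  have "M0 *v e = r0 *s e" "M0 *v e' = (1 / r0) *s e'"
    using assms(3,4) by (auto simp: is_eigenvector_def entrywise algebra_simps)
  then have "wedge e u = 0" "wedge e' v = 0"
    using eigenvector_unique[OF frame0 d0_nz] by blast+
  then obtain \<alpha> \<beta> where e: "e = \<alpha> *s u" "e' = \<beta> *s v"
    using wedge_eq_0D frame_nz(1,2) by blast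
  have nz: "\<alpha> \<noteq> 0" "\<beta> \<noteq> 0" using w e by auto
  show ?thesis
  proof
    assume "\<exists>g h. g \<noteq> 0 \<and> h \<noteq> 0 \<and> K = mat2 g 0 0 h ** matrix_inv (cols e e')"
    then obtain g h where "g \<noteq> 0" "h \<noteq> 0" and K: "K = mat2 g 0 0 h ** matrix_inv (cols e e')"
      by blast
    note I = cmat_inv_diag[OF w \<open>g \<noteq> 0\<close> \<open>h \<noteq> 0\<close>, folded K]
    have "(1 / g) *s e = (\<alpha> / g) *s u" "(1 / h) *s e' = (\<beta> / (h * \<sigma>)) *s v'"
      unfolding e v'(1) using v'(2) by (simp_all add: vector_smult_assoc)
    with I(2) have "matrix_inv K = cols ((\<alpha> / g) *s u) ((\<beta> / (h * \<sigma>)) *s v')" by simp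
    then show "invertible K \<and> intertwines M0 M1 r0 r1 0 0 K"
      unfolding intertwines_iff[OF I(1)] using I(1) assms(1,2)
      by (intro conjI exI[of _ "\<alpha> / g"] exI[of _ "\<beta> / (h * \<sigma>)"]) simp_all
  next
    assume K: "invertible K \<and> intertwines M0 M1 r0 r1 0 0 K"
    then obtain a b where ab: "matrix_inv K = cols (a *s u) (b *s v')"
      using intertwines_iff by blast
    have "det (matrix_inv K) \<noteq> 0" using K cmat_inv(3) by (simp flip: invertible_det_nz)
    then have ab_nz: "a \<noteq> 0" "b \<noteq> 0" by (auto simp: ab det_cols)
    \<comment> \<open>Obtained by equating the columns a \<open>u\<close> with \<open>e\<close>/g
      and b \<open>v'\<close> with \<open>e'\<close>/h.\<close>
    define g h where "g = \<alpha> / a" and "h = \<beta> / (b * \<sigma>)"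
    have gh: "g \<noteq> 0" "h \<noteq> 0" using nz ab_nz v'(2) by (simp_all add: g_def h_def)
    have "matrix_inv K = cols ((1 / g) *s e) ((1 / h) *s e')"
      unfolding ab e v'(1) using nz v'(2) by (simp add: g_def h_def vector_smult_assoc)
    also have "\<dots> = matrix_inv (mat2 g 0 0 h ** matrix_inv (cols e e'))"
      using cmat_inv_diag(2)[OF w gh] by simp
    finally have "K = mat2 g 0 0 h ** matrix_inv (cols e e')"
      using K cmat_inv(4) cmat_inv_diag(1)[OF w gh] by metis
    then show "\<exists>g h. g \<noteq> 0 \<and> h \<noteq> 0 \<and> K = mat2 g 0 0 h ** matrix_inv (cols e e')"
      using gh by blast
  qed
qed

text \<open>The intertwining equations are homogeneous in \<open>K\<close>, which accounts for the
  scalar c. As \<open>e\<close>, \<open>e'\<close> need not have determinant 1, lying in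
  \<open>SL2\<close> means g h = \<open>det (cols e e')\<close> for the diagonal factor; fixing a
  square root c of this number leaves k as the only parameter.\<close>

lemma diagonal_matrices:
  assumes "q = 0" "r = 0" "is_eigenvector M0 r0 e" "is_eigenvector M0 (1 / r0) e'" "r0 \<noteq> 0"
  defines "K0 \<equiv> matrix_inv (cols e e')"
  shows "invertible K0" "matrix_inv K0 = cols e e'"
    and "k \<noteq> 0 \<Longrightarrow> intertwines M0 M1 r0 r1 0 0 (sigma3_pow k ** K0)"
    and "{K. invertible K \<and> intertwines M0 M1 r0 r1 0 0 K} =
      {mat c ** (sigma3_pow k ** K0) | c k. c \<noteq> 0 \<and> k \<noteq> 0}"
    and "c ^ 2 = det (cols e e') \<Longrightarrow> problem_matrices M0 M1 r0 r1 0 0 =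
      {mat c ** (sigma3_pow k ** K0) | k. k \<noteq> 0}"
proof -
  have w: "wedge e e' \<noteq> 0" using normalized_eigenvectors_exist(1) assms(3-5) d0_nz by blast
  then have inv: "invertible (cols e e')" by (simp add: invertible_det_nz det_cols)
  show "invertible K0" "matrix_inv K0 = cols e e'" using cmat_inv[OF inv] by (simp_all add: K0_def)
  note iff = intertwines_diagonal_iff[OF assms(1-4) w, folded K0_def]
  show "intertwines M0 M1 r0 r1 0 0 (sigma3_pow k ** K0)" if "k \<noteq> 0"
  proof -
    have "sigma3_pow k ** K0 = mat2 k 0 0 (1 / k) ** K0" by (simp add: sigma3_pow_def)
    moreover have "1 / k \<noteq> 0" using that by simp
    ultimately show ?thesis using iff that by blast
  qed
  show "{K. invertible K \<and> intertwines M0 M1 r0 r1 0 0 K} =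
      {mat c ** (sigma3_pow k ** K0) | c k. c \<noteq> 0 \<and> k \<noteq> 0}"
    unfolding iff scaled_sigma3
  proof (intro equalityI subsetI; elim CollectE exE conjE)
    fix K g h assume "g \<noteq> 0" "h \<noteq> 0" "K = mat2 g 0 0 h ** K0"
    then show "K \<in> {mat2 (c * k) 0 0 (c / k) ** K0 | c k. c \<noteq> 0 \<and> k \<noteq> 0}"
      using sigma3_parametrization[of g h] by blast
  next
    fix K c k assume "c \<noteq> 0" "k \<noteq> 0" "K = mat2 (c * k) 0 0 (c / k) ** K0"
    moreover from this have "c * k \<noteq> 0" "c / k \<noteq> 0" by simp_all
    ultimately show "K \<in> {K. \<exists>g h. g \<noteq> 0 \<and> h \<noteq> 0 \<and> K = mat2 g 0 0 h ** K0}" by blast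
  qed
  show "problem_matrices M0 M1 r0 r1 0 0 = {mat c ** (sigma3_pow k ** K0) | k. k \<noteq> 0}"
    if c: "c ^ 2 = det (cols e e')"
  proof -
    have c0: "c \<noteq> 0" using c w by (auto simp: det_cols)
    have "K \<in> problem_matrices M0 M1 r0 r1 0 0 \<longleftrightarrow>
        det K = 1 \<and> (invertible K \<and> intertwines M0 M1 r0 r1 0 0 K)" for K
      by (auto simp: problem_matrices_def SL2_def invertible_det_nz)
    moreover have "det K = 1 \<and> (invertible K \<and> intertwines M0 M1 r0 r1 0 0 K) \<longleftrightarrow>
        (\<exists>k. k \<noteq> 0 \<and> K = mat2 (c * k) 0 0 (c / k) ** K0)"
      for K
    proof -
      have "det K0 * c ^ 2 = 1"
        using arg_cong[OF cmat_inv(2)[OF inv], of det] by (simp add: det_mul K0_def c)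
      then have "det K0 = 1 / c ^ 2" using c0 by (simp add: field_simps)
      then have "det (mat2 g 0 0 h ** K0) = 1 \<longleftrightarrow> g * h = c ^ 2" for g h
        using c0 by (simp add: det_mul det_mat2)
      moreover have "g * h = c ^ 2 \<longleftrightarrow> (\<exists>k. k \<noteq> 0 \<and> g = c * k \<and> h = c / k)" for g h
      proof
        assume gh: "g * h = c ^ 2"
        then have "g \<noteq> 0" using c0 by auto
        then have "g / c \<noteq> 0" "g = c * (g / c)" "h = c / (g / c)"
          using c0 gh by (auto simp: field_simps power2_eq_square)
        then show "\<exists>k. k \<noteq> 0 \<and> g = c * k \<and> h = c / k" by blast
      qed (auto simp: power2_eq_square)
      ultimately show ?thesis unfolding iff
        using c0 by (metis divide_eq_0_iff mult_eq_0_iff)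
    qed
    ultimately show ?thesis unfolding scaled_sigma3 by blast
  qed
qed

section \<open>The equivalent trace and determinant formulas for f0 f1\<close>

lemma trace_swapped:
  "trace ((M1 - mat r1) ** (M0 - mat (1 / r0))) = q * r * (d0 * d1)"
    "trace ((M1 - mat (1 / r1)) ** (M0 - mat r0)) = q * r * (d0 * d1)"
  using trace_pm trace_mp trace_mul_sym by metis+

text \<open>The relation p s = 1 + q r, multiplied by d0 d1.\<close>

lemma trace_pp_eq: "trace ((M0 - mat (1 / r0)) ** (M1 - mat (1 / r1))) - d0 * d1 = q * r * (d0 * d1)"
proof -
  have "p * s * (d0 * d1) - d0 * d1 = (p * s - q * r - 1) * (d0 * d1) + q * r * (d0 * d1)"
    by algebra
  then show ?thesis unfolding trace_pp ps_qr by simp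
qed

text \<open>Polarizing the determinant gives det(A + B) the mixed term tr A tr B - tr(A B). This
  expresses tr(\<open>M0\<close> \<open>M1\<close>) through det(\<open>M0\<close> +
  \<open>M1\<close>), and the single traces are known from the eigenvalues.\<close>

lemma trace_pp_det:
  assumes "det M0 = 1" "det M1 = 1" "r0 \<noteq> 0" "r1 \<noteq> 0"
  shows "trace ((M0 - mat (1 / r0)) ** (M1 - mat (1 / r1))) - d0 * d1 =
    (r0 + r1) * (1 / r0 + 1 / r1) - det (M0 + M1)"
  unfolding trace_shift_mult det_add_2 trace_normalized_eigenvectors[OF frame0]
    trace_normalized_eigenvectors[OF frame1] assms(1,2)
  using assms(3,4) by (simp add: field_simps)

end

section \<open>The case distinction by the vanishing of p, q, r, s\<close>

lemma ball_pairI: "(\<And>a b. (a, b) \<in> S \<Longrightarrow> P a b) \<Longrightarrow> \<forall>(a, b) \<in> S. P a b"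
  by auto

text \<open>Cases 3a and 3b overlap when p = s = 0, where the Problem is unsolvable; hence the
  claims of 3b are made outside 3a. In 1a and 1b the special choice of eigenvectors is asserted to
  exist, and the formulas are proved for every such choice.\<close>

theorem theoremA1:
  fixes M06 M16 :: "complex ^ 2 ^ 2" and r0 r1 :: complex
  assumes "M06 \<in> SL2" and "M16 \<in> SL2"
    and "eigenvalues M06 = {r0, 1 / r0}" and "eigenvalues M16 = {r1, 1 / r1}"
    and "r0 \<notin> {0, 1, -1}" and "r1 \<notin> {0, 1, -1}"
  defines "case_1a \<equiv> (M06 - mat r0) ** (M16 - mat (1 / r1)) = 0 \<and>
                     (M16 - mat r1) ** (M06 - mat (1 / r0)) = 0"
    and "case_1b \<equiv> (M06 - mat (1 / r0)) ** (M16 - mat r1) = 0 \<and>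
                   (M16 - mat (1 / r1)) ** (M06 - mat r0) = 0"
    and "case_3a \<equiv> (M06 - mat r0) ** (M16 - mat r1) = 0 \<and>
                   (M16 - mat (1 / r1)) ** (M06 - mat (1 / r0)) = 0"
    and "case_3b \<equiv> (M06 - mat (1 / r0)) ** (M16 - mat (1 / r1)) = 0"
  shows
   "(trace ((M06 - mat (1 / r0)) ** (M16 - mat r1)) = 0 \<and> commutator M06 M16 \<noteq> 0 \<longrightarrow>
      solvable M06 M16 r0 r1 \<and>
      (case_1a \<or> case_1b) \<and>
      (case_1a \<longrightarrow>
         problem_solutions M06 M16 r0 r1 = {(f0, f1). f0 \<noteq> 0 \<and> f1 = 0} \<and>
         (\<exists>e0p e0m e1p e1m. normalized_eigenvectors M06 r0 e0p e0m \<and>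
            normalized_eigenvectors M16 r1 e1p e1m \<and> e1p = e0p) \<and>
         (\<forall>e0p e0m e1p e1m. normalized_eigenvectors M06 r0 e0p e0m \<and>
            normalized_eigenvectors M16 r1 e1p e1m \<and> e1p = e0p \<longrightarrow>
            (\<exists>\<alpha>0 \<beta>0. \<alpha>0 \<noteq> 0 \<and> \<beta>0 \<noteq> 0 \<and> e1m = \<alpha>0 *s e0p + \<beta>0 *s e0m \<and>
               (\<forall>(f0, f1) \<in> problem_solutions M06 M16 r0 r1.
                  (\<exists>K. K \<noteq> - K \<and> problem_matrices M06 M16 r0 r1 f0 f1 = {K, - K}) \<and>
                  problem_matrices M06 M16 r0 r1 f0 f1 =
                    matrices_via_sqrt (\<alpha>0 * (r0 - 1 / r0) / f0)
                      (\<lambda>\<kappa>1. cols e1p e1m ** sigma3_pow \<kappa>1))))) \<and>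
      (case_1b \<longrightarrow>
         problem_solutions M06 M16 r0 r1 = {(f0, f1). f0 = 0 \<and> f1 \<noteq> 0} \<and>
         (\<exists>e0p e0m e1p e1m. normalized_eigenvectors M06 r0 e0p e0m \<and>
            normalized_eigenvectors M16 r1 e1p e1m \<and> e1m = e0m) \<and>
         (\<forall>e0p e0m e1p e1m. normalized_eigenvectors M06 r0 e0p e0m \<and>
            normalized_eigenvectors M16 r1 e1p e1m \<and> e1m = e0m \<longrightarrow>
            (\<exists>\<alpha>1 \<beta>1. \<alpha>1 \<noteq> 0 \<and> \<beta>1 \<noteq> 0 \<and> e0p = \<alpha>1 *s e1p + \<beta>1 *s e1m \<and>
               (\<forall>(f0, f1) \<in> problem_solutions M06 M16 r0 r1.
                  (\<exists>K. K \<noteq> - K \<and> problem_matrices M06 M16 r0 r1 f0 f1 = {K, - K}) \<and>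
                  problem_matrices M06 M16 r0 r1 f0 f1 =
                    matrices_via_sqrt (f1 / (\<beta>1 * (1 / r1 - r1)))
                      (\<lambda>\<kappa>0. cols e0p e0m ** sigma3_pow \<kappa>0)))))) \<and>

    (trace ((M06 - mat (1 / r0)) ** (M16 - mat r1)) = 0 \<and> commutator M06 M16 = 0 \<longrightarrow>
      solvable M06 M16 r0 r1 \<and>
      problem_solutions M06 M16 r0 r1 = {(0, 0)} \<and>
      (\<forall>e0p e0m. unit_eigenvectors M06 r0 e0p e0m \<longrightarrow>
         (\<exists>K0. invertible K0 \<and> matrix_inv K0 = cols e0p e0m \<and>
            (\<forall>k. k \<noteq> 0 \<longrightarrow> intertwines M06 M16 r0 r1 0 0 (sigma3_pow k ** K0)) \<and>
            {K. invertible K \<and> intertwines M06 M16 r0 r1 0 0 K} =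
              {mat c ** (sigma3_pow k ** K0) | c k. c \<noteq> 0 \<and> k \<noteq> 0} \<and>
            (\<forall>c. c ^ 2 = det (cols e0p e0m) \<longrightarrow>
               problem_matrices M06 M16 r0 r1 0 0 =
                 {mat c ** (sigma3_pow k ** K0) | k. k \<noteq> 0})))) \<and>

    (trace ((M06 - mat (1 / r0)) ** (M16 - mat (1 / r1))) = 0 \<longrightarrow>
      (case_3a \<or> case_3b) \<and>
      (case_3a \<longrightarrow> \<not> solvable M06 M16 r0 r1) \<and>
      (case_3b \<and> \<not> case_3a \<longrightarrow>
         solvable M06 M16 r0 r1 \<and>
         problem_solutions M06 M16 r0 r1 =
           {(f0, f1). f0 \<noteq> 0 \<and> f1 \<noteq> 0 \<and> f0 * f1 = - (r0 - 1 / r0) * (r1 - 1 / r1)} \<and>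
         (\<forall>e0p e0m e1p e1m. normalized_eigenvectors M06 r0 e0p e0m \<and>
            normalized_eigenvectors M16 r1 e1p e1m \<longrightarrow>
            (\<exists>p q r s. p * s - q * r = 1 \<and>
               e1p = p *s e0p + q *s e0m \<and> e1m = r *s e0p + s *s e0m \<and>
               (\<forall>(f0, f1) \<in> problem_solutions M06 M16 r0 r1.
                  (\<exists>K. K \<noteq> - K \<and> problem_matrices M06 M16 r0 r1 f0 f1 = {K, - K}) \<and>
                  problem_matrices M06 M16 r0 r1 f0 f1 =
                    star_matrices r1 f1 q s e0p e1m))))) \<and>

    (trace ((M06 - mat (1 / r0)) ** (M16 - mat r1)) \<noteq> 0 \<and>
     trace ((M06 - mat (1 / r0)) ** (M16 - mat (1 / r1))) \<noteq> 0 \<longrightarrow>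
      solvable M06 M16 r0 r1 \<and>
      problem_solutions M06 M16 r0 r1 =
        {(f0, f1). f0 \<noteq> 0 \<and> f1 \<noteq> 0 \<and>
           f0 * f1 = trace ((M16 - mat r1) ** (M06 - mat (1 / r0)))} \<and>
      trace ((M16 - mat r1) ** (M06 - mat (1 / r0))) =
        trace ((M16 - mat (1 / r1)) ** (M06 - mat r0)) \<and>
      trace ((M16 - mat (1 / r1)) ** (M06 - mat r0)) =
        trace ((M06 - mat (1 / r0)) ** (M16 - mat (1 / r1))) - (r0 - 1 / r0) * (r1 - 1 / r1) \<and>
      trace ((M06 - mat (1 / r0)) ** (M16 - mat (1 / r1))) - (r0 - 1 / r0) * (r1 - 1 / r1) =
        (r0 + r1) * (1 / r0 + 1 / r1) - det (M06 + M16) \<and>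
      (\<forall>e0p e0m e1p e1m. normalized_eigenvectors M06 r0 e0p e0m \<and>
         normalized_eigenvectors M16 r1 e1p e1m \<longrightarrow>
         (\<exists>p q r s. p * s - q * r = 1 \<and>
            e1p = p *s e0p + q *s e0m \<and> e1m = r *s e0p + s *s e0m \<and>
            (\<forall>(f0, f1) \<in> problem_solutions M06 M16 r0 r1.
               card (problem_matrices M06 M16 r0 r1 f0 f1) = 2 \<and>
               problem_matrices M06 M16 r0 r1 f0 f1 =
                 star_matrices r1 f1 q s e0p e1m))))"
proof -
  have r_nz: "r0 \<noteq> 0" "r1 \<noteq> 0" using assms(5,6) by auto
  have "r0 ^ 2 \<noteq> 1" "r1 ^ 2 \<noteq> 1" using assms(5,6) by (auto simp: power2_eq_1_iff)
  then have d_nz: "r0 - 1 / r0 \<noteq> 0" "r1 - 1 / r1 \<noteq> 0"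
    using r_nz by (auto simp: field_simps power2_eq_square)
  have det: "det M06 = 1" "det M16 = 1" using assms(1,2) by (auto simp: SL2_def)
  have frame: "eigenframes M06 M16 r0 r1 u v u' v'"
    if "normalized_eigenvectors M06 r0 u v" "normalized_eigenvectors M16 r1 u' v'" for u v u' v'
    using that d_nz by unfold_locales
  have "r0 \<in> eigenvalues M06" "1 / r0 \<in> eigenvalues M06"
    "r1 \<in> eigenvalues M16" "1 / r1 \<in> eigenvalues M16"
    using assms(3,4) by auto
  then obtain x0 y0 x1 y1 where eig: "is_eigenvector M06 r0 x0" "is_eigenvector M06 (1 / r0) y0"
      "is_eigenvector M16 r1 x1" "is_eigenvector M16 (1 / r1) y1"
    unfolding eigenvalues_def by blast
  note ex0 = normalized_eigenvectors_exist[OF _ _ r_nz(1) d_nz(1)]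
  note ex1 = normalized_eigenvectors_exist[OF _ _ r_nz(2) d_nz(2)]
  obtain u v u' v' where uv: "normalized_eigenvectors M06 r0 u v" "normalized_eigenvectors M16 r1 u' v'"
    using ex0(2)[OF eig(1,2)] ex1(2)[OF eig(3,4)] by blast
  \<comment> \<open>This fixed choice of frames serves all claims that mention only the matrices and
    the solution pairs.\<close>
  interpret F: eigenframes M06 M16 r0 r1 u v u' v' by (rule frame[OF uv])
  note cases_iff = case_1a_def case_1b_def case_3a_def case_3b_def F.products_eq_0_iff
  have sqrt_eq: "cols x y ** sigma3_pow k = cols (k *s x) ((1 / k) *s y)" for x y k
    by (simp add: sigma3_pow_def cols_mult_mat2)
  have solvableI: "solvable M06 M16 r0 r1" if "(a, b) \<in> problem_solutions M06 M16 r0 r1" for a b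
    using that by (auto simp: solvable_def)

  have tr1: "trace ((M06 - mat (1 / r0)) ** (M16 - mat r1)) = 0 \<longleftrightarrow> F.q * F.r = 0"
    unfolding F.trace_pm using d_nz by simp
  have tr3: "trace ((M06 - mat (1 / r0)) ** (M16 - mat (1 / r1))) = 0 \<longleftrightarrow> F.p * F.s = 0"
    unfolding F.trace_pp using d_nz by simp

  have sol_1a: "problem_solutions M06 M16 r0 r1 = {(f0, f1). f0 \<noteq> 0 \<and> f1 = 0}"
    if "F.q = 0" "F.r \<noteq> 0" using F.solutions_upper(1) that .
  have sol_1b: "problem_solutions M06 M16 r0 r1 = {(f0, f1). f0 = 0 \<and> f1 \<noteq> 0}"
    if "F.q \<noteq> 0" "F.r = 0"
  proof -
    have "F.s \<noteq> 0" using F.ps_qr that by auto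
    from F.solutions_lower(1)[OF that(1) this] that(2) show ?thesis by auto
  qed
  have sol_lower: "problem_solutions M06 M16 r0 r1 =
      {(f0, f1). f0 \<noteq> 0 \<and> f1 \<noteq> 0 \<and> f0 * f1 = F.q * F.r * (F.d0 * F.d1)}"
    if "F.q \<noteq> 0" "F.r \<noteq> 0" "F.s \<noteq> 0"
    unfolding F.solutions_lower(1)[OF that(1,3)] using that d_nz by auto
  have solvable_lower: "solvable M06 M16 r0 r1" if "F.q \<noteq> 0" "F.r \<noteq> 0" "F.s \<noteq> 0"
    using that d_nz
    by (intro solvableI[of "F.q * F.r * (F.d0 * F.d1)" 1]) (simp add: sol_lower[OF that])

  \<comment> \<open>The goals follow the statement: 1 to 8 are case 1 (3 to 5 for 1a, 6 to 8 for
    1b), 9 to 11 case 2, 12 to 16 case 3, 17 to 22 case 4.\<close>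
  show ?thesis
  proof (intro conjI impI, goal_cases)
    case 1
    then consider "F.q = 0" "F.r \<noteq> 0" | "F.q \<noteq> 0" "F.r = 0"
      using tr1 F.commutator_eq_0_iff by auto
    then show ?case
    proof cases
      case 1
      show ?thesis by (rule solvableI[of 1 0]) (simp add: sol_1a[OF 1])
    next
      case 2
      show ?thesis by (rule solvableI[of 0 1]) (simp add: sol_1b[OF 2])
    qed
  next
    case 2
    then show ?case unfolding cases_iff tr1 by simp
  next
    case 3
    then show ?case unfolding cases_iff using tr1 F.commutator_eq_0_iff by (intro sol_1a) auto
  next
    case 4
    then have "F.q = 0" by (simp add: cases_iff)
    \<comment> \<open>Since q = 0, the vector \<open>u\<close> is itself an eigenvector of
      \<open>M16\<close> for r1 and can serve as the common one; only its partner is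
      rescaled.\<close>
    then have "M16 *v u = r1 *s u"
      using eigenvector_unique(1)[OF uv(2) d_nz(2), of u] by simp
    then have "is_eigenvector M16 r1 u"
      using F.frame_nz by (simp add: is_eigenvector_def entrywise algebra_simps)
    then show ?case using uv(1) ex1(2)[OF _ eig(4)] by blast
  next
    case 5
    show ?case
    proof (intro allI impI, elim conjE)
      fix e0p e0m e1p e1m
      assume e: "normalized_eigenvectors M06 r0 e0p e0m" "normalized_eigenvectors M16 r1 e1p e1m"
        "e1p = e0p"
      interpret G: eigenframes M06 M16 r0 r1 e0p e0m e1p e1m by (rule frame[OF e(1,2)])
      \<comment> \<open>Sharing the first eigenvector turns p and s into the determinants of the two
        frames. With s = 1 the columns scale by reciprocal factors, as in \<open>sigma3_pow\<close>,
        and the constants are \<alpha>0 = r, \<beta>0 = 1.\<close>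
      have G: "G.q = 0" "G.p = 1" "G.s = 1" using e(3) G.D0(1) G.D1(1) by simp_all
      then have r: "G.r \<noteq> 0" using 5 G.commutator_eq_0_iff by auto
      have "(\<exists>K. K \<noteq> - K \<and> problem_matrices M06 M16 r0 r1 f0 f1 = {K, - K}) \<and>
          problem_matrices M06 M16 r0 r1 f0 f1 = matrices_via_sqrt (G.r * (r0 - 1 / r0) / f0)
            (\<lambda>\<kappa>. cols e1p e1m ** sigma3_pow \<kappa>)"
        if "(f0, f1) \<in> problem_solutions M06 M16 r0 r1" for f0 f1
        using G.solutions_upper(2)[OF G(1) r that]
        unfolding sqrt_eq G(3) e(3) mult_1_left mult_1_right .
      then show "\<exists>\<alpha>0 \<beta>0. \<alpha>0 \<noteq> 0 \<and> \<beta>0 \<noteq> 0 \<and> e1m = \<alpha>0 *s e0p + \<beta>0 *s e0m \<and>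
          (\<forall>(f0, f1) \<in> problem_solutions M06 M16 r0 r1.
            (\<exists>K. K \<noteq> - K \<and> problem_matrices M06 M16 r0 r1 f0 f1 = {K, - K}) \<and>
            problem_matrices M06 M16 r0 r1 f0 f1 = matrices_via_sqrt (\<alpha>0 * (r0 - 1 / r0) / f0)
              (\<lambda>\<kappa>1. cols e1p e1m ** sigma3_pow \<kappa>1))"
        using r G(3) by (intro exI[of _ G.r] exI[of _ G.s] conjI G.v'_eq) auto
    qed
  next
    case 6
    then show ?case unfolding cases_iff using tr1 F.commutator_eq_0_iff by (intro sol_1b) auto
  next
    case 7
    then have "wedge v v' = 0" by (simp add: cases_iff wedge_swap[of v v'])
    then have "M16 *v v = (1 / r1) *s v"
      using eigenvector_unique(2)[OF uv(2) d_nz(2), of v] by simp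
    then have "is_eigenvector M16 (1 / r1) v"
      using F.frame_nz by (simp add: is_eigenvector_def entrywise algebra_simps)
    then show ?case using uv(1) ex1(3)[OF eig(3)] by blast
  next
    case 8
    show ?case
    proof (intro allI impI, elim conjE)
      fix e0p e0m e1p e1m
      assume e: "normalized_eigenvectors M06 r0 e0p e0m" "normalized_eigenvectors M16 r1 e1p e1m"
        "e1m = e0m"
      interpret G: eigenframes M06 M16 r0 r1 e0p e0m e1p e1m by (rule frame[OF e(1,2)])
      have G: "G.r = 0" "G.p = 1" "G.s = 1" using e(3) G.D0(1) G.D1(1) by simp_all
      then have q: "G.q \<noteq> 0" using 8 G.commutator_eq_0_iff by auto
      have s: "G.s \<noteq> 0" using G(3) by simp
      \<comment> \<open>Here \<beta>1 = -q, and the sign is compensated by 1/r1 - r1 in place of r1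
        - 1/r1.\<close>
      have w: "f1 / (- G.q * (1 / r1 - r1)) = f1 / (G.q * G.s * (r1 - 1 / r1))" for f1
        by (simp add: G(3) algebra_simps)
      have "(\<exists>K. K \<noteq> - K \<and> problem_matrices M06 M16 r0 r1 f0 f1 = {K, - K}) \<and>
          problem_matrices M06 M16 r0 r1 f0 f1 = matrices_via_sqrt (f1 / (- G.q * (1 / r1 - r1)))
            (\<lambda>\<kappa>. cols e0p e0m ** sigma3_pow \<kappa>)"
        if "(f0, f1) \<in> problem_solutions M06 M16 r0 r1" for f0 f1
        using G.solutions_lower(2)[OF q s that]
        unfolding w sqrt_eq star_matrices_def e(3) G.D0(1) mult_1_left mult_1_right .
      then show "\<exists>\<alpha>1 \<beta>1. \<alpha>1 \<noteq> 0 \<and> \<beta>1 \<noteq> 0 \<and> e0p = \<alpha>1 *s e1p + \<beta>1 *s e1m \<and>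
          (\<forall>(f0, f1) \<in> problem_solutions M06 M16 r0 r1.
            (\<exists>K. K \<noteq> - K \<and> problem_matrices M06 M16 r0 r1 f0 f1 = {K, - K}) \<and>
            problem_matrices M06 M16 r0 r1 f0 f1 = matrices_via_sqrt (f1 / (\<beta>1 * (1 / r1 - r1)))
              (\<lambda>\<kappa>0. cols e0p e0m ** sigma3_pow \<kappa>0))"
        using q G(3) by (intro exI[of _ G.s] exI[of _ "- G.q"] conjI G.u_eq) auto
    qed
  next
    case 9
    then have "F.q = 0" "F.r = 0" using tr1 F.commutator_eq_0_iff by auto
    then show ?case using F.solutions_diagonal by (intro solvableI[of 0 0]) simp
  next
    case 10
    then have "F.q = 0" "F.r = 0" using tr1 F.commutator_eq_0_iff by auto
    then show ?case by (rule F.solutions_diagonal)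
  next
    case 11
    then have qr: "F.q = 0" "F.r = 0" using tr1 F.commutator_eq_0_iff by auto
    show ?case
    proof (intro allI impI)
      fix e0p e0m assume "unit_eigenvectors M06 r0 e0p e0m"
      then have e: "is_eigenvector M06 r0 e0p" "is_eigenvector M06 (1 / r0) e0m"
        by (simp_all add: unit_eigenvectors_def)
      show "\<exists>K0. invertible K0 \<and> matrix_inv K0 = cols e0p e0m \<and>
          (\<forall>k. k \<noteq> 0 \<longrightarrow> intertwines M06 M16 r0 r1 0 0 (sigma3_pow k ** K0)) \<and>
          {K. invertible K \<and> intertwines M06 M16 r0 r1 0 0 K} =
            {mat c ** (sigma3_pow k ** K0) | c k. c \<noteq> 0 \<and> k \<noteq> 0} \<and>
          (\<forall>c. c ^ 2 = det (cols e0p e0m) \<longrightarrow>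
             problem_matrices M06 M16 r0 r1 0 0 = {mat c ** (sigma3_pow k ** K0) | k. k \<noteq> 0})"
        using F.diagonal_matrices[OF qr e r_nz(1)] by blast
    qed
  next
    case 12
    then show ?case unfolding cases_iff tr3 by auto
  next
    case 13
    then show ?case unfolding cases_iff using F.not_solvable by simp
  next
    case 14
    then have "F.p = 0" "F.s \<noteq> 0" by (auto simp: cases_iff)
    moreover from this have "F.q \<noteq> 0" "F.r \<noteq> 0" using F.ps_qr by auto
    ultimately show ?case using solvable_lower by blast
  next
    case 15
    then have ps: "F.p = 0" "F.s \<noteq> 0" by (auto simp: cases_iff)
    \<comment> \<open>With p = 0, p s - q r = 1 fixes q r = -1, which turns the general product q r
      d0 d1 into the one of case 3b.\<close>
    then have qr: "F.q * F.r = - 1" using F.ps_qr by (simp add: minus_equation_iff)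
    then have nz: "F.q \<noteq> 0" "F.r \<noteq> 0" by auto
    have "- 1 * (F.d0 * F.d1) = - F.d0 * F.d1" by algebra
    with sol_lower[OF nz ps(2)] show ?case unfolding qr by (simp only:)
  next
    case 16
    show ?case
    proof (intro allI impI, elim conjE)
      fix e0p e0m e1p e1m
      assume e: "normalized_eigenvectors M06 r0 e0p e0m" "normalized_eigenvectors M16 r1 e1p e1m"
      interpret G: eigenframes M06 M16 r0 r1 e0p e0m e1p e1m by (rule frame[OF e])
      \<comment> \<open>In any frame 3b says p = 0, and the failure of 3a says that s is
        nonzero.\<close>
      have "G.p = 0" and s: "G.s \<noteq> 0" using 16
        by (auto simp: case_3a_def case_3b_def G.products_eq_0_iff)
      then have q: "G.q \<noteq> 0" using G.ps_qr by auto
      have lower: "(\<exists>K. K \<noteq> - K \<and> problem_matrices M06 M16 r0 r1 f0 f1 = {K, - K}) \<and>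
          problem_matrices M06 M16 r0 r1 f0 f1 = star_matrices r1 f1 G.q G.s e0p e1m"
        if "(f0, f1) \<in> problem_solutions M06 M16 r0 r1" for f0 f1
        using G.solutions_lower(2)[OF q s that] .
      show "\<exists>p q r s. p * s - q * r = 1 \<and>
          e1p = p *s e0p + q *s e0m \<and> e1m = r *s e0p + s *s e0m \<and>
          (\<forall>(f0, f1) \<in> problem_solutions M06 M16 r0 r1.
            (\<exists>K. K \<noteq> - K \<and> problem_matrices M06 M16 r0 r1 f0 f1 = {K, - K}) \<and>
            problem_matrices M06 M16 r0 r1 f0 f1 = star_matrices r1 f1 q s e0p e1m)"
        by (rule exI[of _ G.p], rule exI[of _ G.q], rule exI[of _ G.r], rule exI[of _ G.s],
            intro conjI G.ps_qr G.u'_eq G.v'_eq, rule ball_pairI, erule lower)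
    qed
  next
    case 17
    then show ?case using tr1 tr3 by (intro solvable_lower) auto
  next
    case 18
    then show ?case unfolding F.trace_swapped tr1 tr3 by (intro sol_lower) auto
  next
    case 19
    show ?case unfolding F.trace_swapped ..
  next
    case 20
    show ?case unfolding F.trace_swapped F.trace_pp_eq ..
  next
    case 21
    show ?case using F.trace_pp_det[OF det r_nz] .
  next
    case 22
    show ?case
    proof (intro allI impI, elim conjE)
      fix e0p e0m e1p e1m
      assume e: "normalized_eigenvectors M06 r0 e0p e0m" "normalized_eigenvectors M16 r1 e1p e1m"
      interpret G: eigenframes M06 M16 r0 r1 e0p e0m e1p e1m by (rule frame[OF e])
      have q: "G.q \<noteq> 0" and s: "G.s \<noteq> 0" using 22 unfolding G.trace_pm G.trace_pp by auto
      have lower: "card (problem_matrices M06 M16 r0 r1 f0 f1) = 2 \<and>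
          problem_matrices M06 M16 r0 r1 f0 f1 = star_matrices r1 f1 G.q G.s e0p e1m"
        if "(f0, f1) \<in> problem_solutions M06 M16 r0 r1" for f0 f1
        using G.solutions_lower(2)[OF q s that] by (metis card_2_iff)
      show "\<exists>p q r s. p * s - q * r = 1 \<and>
          e1p = p *s e0p + q *s e0m \<and> e1m = r *s e0p + s *s e0m \<and>
          (\<forall>(f0, f1) \<in> problem_solutions M06 M16 r0 r1.
            card (problem_matrices M06 M16 r0 r1 f0 f1) = 2 \<and>
            problem_matrices M06 M16 r0 r1 f0 f1 = star_matrices r1 f1 q s e0p e1m)"
        by (rule exI[of _ G.p], rule exI[of _ G.q], rule exI[of _ G.r], rule exI[of _ G.s],
            intro conjI G.ps_qr G.u'_eq G.v'_eq, rule ball_pairI, erule lower)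
    qed
  qed
qed

end
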